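(* Suppose that $\theta>0$, $a,b\in\mathbb{R}$, $\rho\in\mathbb{R}\setminus\{0\}$. The geodesics of the perturbed Ornstein-Uhlenbeck operator $L=-\theta\,\partial_x^2+(ax+b)\partial_x+\rho x^2$ of the form $\{x(s)\mid 0\le s\le 1,\ x(0)=x_0,\ x(1)=x\}$ (with $x_0,x\in\mathbb{R}$) are given by the following formulas. 1. If $a^2+4\rho\theta>0$, put $\lambda_0:=\sqrt{a^2+4\rho\theta}$; then $$x(s)=-\frac{ab}{\lambda_0^2}+\left(x_0+\frac{ab}{\lambda_0^2}\right)\frac{\sinh(\lambda_0(1-s))}{\sinh\lambda_0}+\left(x+\frac{ab}{\lambda_0^2}\right)\frac{\sinh(\lambda_0 s)}{\sinh\lambda_0}.$$ 2. If $a^2+4\rho\theta=0$, then $$x(s)=\frac{ab}{2}s^2+\left(x-x_0-\frac{ab}{2}\right)s+x_0.$$ 3. If $a^2+4\rho\theta<0$, put $\lambda_0:=\sqrt{-a^2-4\rho\theta}$. (i) If $\lambda_0\neq k\pi$ for all $k\in\mathbb{Z}^+$, then $$x(s)=\frac{ab}{\lambda_0^2}+\left(x_0-\frac{ab}{\lambda_0^2}\right)\frac{\sin(\lambda_0(1-s))}{\sin\lambda_0}+\left(x-\frac{ab}{\lambda_0^2}\right)\frac{\sin(\lambda_0 s)}{\sin\lambda_0}.$$ (ii) If $\lambda_0=k\pi$ for some $k\in\mathbb{Z}^+$ and $x=\frac{ab}{k^2\pi^2}+(-1)^k\left(x_0-\frac{ab}{k^2\pi^2}\right)$, then $$x(s)=\frac{ab}{\lambda_0^2}+\left(x_0-\frac{ab}{k^2\pi^2}\right)\left(\cos(\lambda_0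 s)+\frac{a}{\lambda_0}\sin(\lambda_0 s)\right)-c_2\sin(\lambda_0 s)$$ with $c_2$ an arbitrary real scalar.
   Context: For $L=-\theta\,\partial_x^2+(ax+b)\partial_x+\rho x^2$, the Hamiltonian is the full symbol $H(x,\xi)=-\theta\xi^2+(ax+b)\xi+\rho x^2$, and the associated Hamiltonian system is $$\dot x=\frac{\partial H}{\partial\xi}=ax-2\theta\xi+b,\qquad \dot\xi=-\frac{\partial H}{\partial x}=-2\rho x-a\xi .$$ A geodesic of $L$ from $x_0$ to $x$ is the $x$-component $x(s)$, $0\le s\le 1$, of a real solution $(x(s),\xi(s))$ of this Hamiltonian system satisfying the boundary conditions $x(0)=x_0$, $x(1)=x$ (no condition is imposed on $\xi$). Here $x$ also denotes the prescribed endpoint. *)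

theory Defs
  imports "HOL-Analysis.Analysis"
begin

text \<open>
  A linear ordinary differential operator \<open>\<Sum>j. c\<^sub>j(x) (d/dx)\<^sup>j\<close> on the real line is
  represented by the list \<open>[c\<^sub>0, c\<^sub>1, \<dots>]\<close> of its coefficient functions.
\<close>

type_synonym diff_op = "(real \<Rightarrow> real) list"

definition apply_diff_op :: "diff_op \<Rightarrow> (real \<Rightarrow> real) \<Rightarrow> real \<Rightarrow> real" where
  "apply_diff_op L f x = (\<Sum>j<length L. (L ! j) x * (deriv ^^ j) f x)"

text \<open>
  The full symbol replaces \<open>d/dx\<close> by \<open>\<xi>\<close>, without a factor of the imaginary unit.
\<close>

definition full_symbol :: "diff_op \<Rightarrow> real \<Rightarrow> real \<Rightarrow> real" where
  "full_symbol L x \<xi> = (\<Sum>j<length L. (L ! j) x * \<xi> ^ j)"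

definition perturbed_OU :: "real \<Rightarrow> real \<Rightarrow> real \<Rightarrow> real \<Rightarrow> diff_op" where
  "perturbed_OU \<theta> a b \<rho> = [\<lambda>x. \<rho> * x\<^sup>2, \<lambda>x. a * x + b, \<lambda>x. - \<theta>]"

lemma apply_perturbed_OU:
  "apply_diff_op (perturbed_OU \<theta> a b \<rho>) f x =
     - \<theta> * deriv (deriv f) x + (a * x + b) * deriv f x + \<rho> * x\<^sup>2 * f x"
  by (simp add: apply_diff_op_def perturbed_OU_def eval_nat_numeral)

lemma full_symbol_perturbed_OU:
  "full_symbol (perturbed_OU \<theta> a b \<rho>) x \<xi> = - \<theta> * \<xi>\<^sup>2 + (a * x + b) * \<xi> + \<rho> * x\<^sup>2"
  by (simp add: full_symbol_def perturbed_OU_def eval_nat_numeral)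

text \<open>
  Derivatives with respect to time are taken within the time interval \<open>S\<close>, hence one-sided at its
  endpoints.
\<close>

definition hamiltonian_solution ::
    "(real \<Rightarrow> real \<Rightarrow> real) \<Rightarrow> real set \<Rightarrow> (real \<Rightarrow> real) \<Rightarrow> (real \<Rightarrow> real) \<Rightarrow> bool" where
  "hamiltonian_solution H S q p \<longleftrightarrow>
     (\<forall>s\<in>S. (q has_real_derivative deriv (\<lambda>\<eta>. H (q s) \<eta>) (p s)) (at s within S) \<and>
            (p has_real_derivative - deriv (\<lambda>y. H y (p s)) (q s)) (at s within S))"

lemma hamiltonian_solution_perturbed_OU:
  "hamiltonian_solution (full_symbol (perturbed_OU \<theta> a b \<rho>)) S q p \<longleftrightarrow>
     (\<forall>s\<in>S. (q has_real_derivative a * q s - 2 * \<theta> * p s + b) (at s within S) \<and>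
            (p has_real_derivative - 2 * \<rho> * q s - a * p s) (at s within S))"
proof -
  have 1: "deriv (\<lambda>\<eta>. full_symbol (perturbed_OU \<theta> a b \<rho>) x \<eta>) \<xi> = a * x - 2 * \<theta> * \<xi> + b" for x \<xi>
    unfolding full_symbol_perturbed_OU
    by (rule DERIV_imp_deriv) (auto intro!: derivative_eq_intros)
  have 2: "- deriv (\<lambda>y. full_symbol (perturbed_OU \<theta> a b \<rho>) y \<xi>) x = - 2 * \<rho> * x - a * \<xi>" for x \<xi>
  proof -
    have "deriv (\<lambda>y. full_symbol (perturbed_OU \<theta> a b \<rho>) y \<xi>) x = 2 * \<rho> * x + a * \<xi>"
      unfolding full_symbol_perturbed_OU
      by (rule DERIV_imp_deriv) (auto intro!: derivative_eq_intros)
    then show ?thesis by simp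
  qed
  show ?thesis
    unfolding hamiltonian_solution_def 1 2 ..
qed

text \<open>
  A geodesic is a curve on \<open>[0, 1]\<close>; the values of the total function \<open>\<gamma>\<close> outside this interval
  are irrelevant.
\<close>

definition geodesic :: "diff_op \<Rightarrow> real \<Rightarrow> real \<Rightarrow> (real \<Rightarrow> real) \<Rightarrow> bool" where
  "geodesic L x\<^sub>0 x \<gamma> \<longleftrightarrow>
     (\<exists>\<xi>. hamiltonian_solution (full_symbol L) {0..1} \<gamma> \<xi>) \<and> \<gamma> 0 = x\<^sub>0 \<and> \<gamma> 1 = x"

end

theory Submission
  imports Defs
begin

text \<open>
  Eliminating the momentum from the Hamiltonian system turns it into the scalar equation
  \<open>q'' = \<mu> q + a b\<close> with \<open>\<mu> = a\<^sup>2 + 4 \<rho> \<theta>\<close>; since \<open>\<theta> \<noteq> 0\<close>, the momentum can conversely be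
  recovered from \<open>q\<close> and \<open>q'\<close> (lemma \<open>geodesic_iff_second_order\<close>).  Let \<open>C\<close> and \<open>S\<close> be the solutions
  of \<open>u'' = \<mu> u\<close> with initial data \<open>(1, 0)\<close> and \<open>(0, 1)\<close>.  The quantities \<open>u C - u' S\<close> and
  \<open>u' C - \<mu> u S\<close> are constant along every solution \<open>u\<close>, which gives \<open>u = u(0) C + u'(0) S\<close>; hence
  the solutions of the scalar equation are \<open>P + c C + d S\<close>, where \<open>P\<close> is any particular solution
  (lemma \<open>geodesic_iff_combination\<close>).

  It remains to fit \<open>c\<close> and \<open>d\<close> to the endpoints.  The left endpoint determines \<open>c\<close>.  If
  \<open>S 1 \<noteq> 0\<close>, the right endpoint determines \<open>d\<close>.  If \<open>S 1 = 0\<close>, then \<open>d\<close> is free and the right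
  endpoint is a solvability condition.  According to the sign of \<open>\<mu>\<close>, \<open>S s\<close> is
  \<open>sinh (\<lambda> s) / \<lambda>\<close>, \<open>s\<close> or \<open>sin (\<lambda> s) / \<lambda>\<close> with \<open>\<lambda> = sqrt \<bar>\<mu>\<bar>\<close>, so that \<open>S 1 = 0\<close> happens
  exactly if \<open>\<mu> < 0\<close> and \<open>\<lambda>\<close> is a positive multiple of \<open>\<pi>\<close>.
\<close>

section \<open>Reduction to a second-order equation\<close>

lemma geodesic_iff_second_order:
  fixes \<theta> a b \<rho> x\<^sub>0 x :: real
  assumes "\<theta> \<noteq> 0"
  shows "geodesic (perturbed_OU \<theta> a b \<rho>) x\<^sub>0 x \<gamma> \<longleftrightarrow>
    (\<exists>v. \<forall>s\<in>{0..1}. (\<gamma> has_real_derivative v s) (at s within {0..1}) \<and>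
        (v has_real_derivative (a\<^sup>2 + 4 * \<rho> * \<theta>) * \<gamma> s + a * b) (at s within {0..1})) \<and>
    \<gamma> 0 = x\<^sub>0 \<and> \<gamma> 1 = x"
    (is "_ \<longleftrightarrow> ?E \<and> _")
proof -
  have "?E" if "hamiltonian_solution (full_symbol (perturbed_OU \<theta> a b \<rho>)) {0..1} \<gamma> \<xi>" for \<xi>
  proof (intro exI ballI conjI)
    fix s :: real assume "s \<in> {0..1}"
    with that have q: "(\<gamma> has_real_derivative a * \<gamma> s - 2 * \<theta> * \<xi> s + b) (at s within {0..1})"
      and p: "(\<xi> has_real_derivative - 2 * \<rho> * \<gamma> s - a * \<xi> s) (at s within {0..1})"
      unfolding hamiltonian_solution_perturbed_OU by blast+
    show "(\<gamma> has_real_derivative a * \<gamma> s - 2 * \<theta> * \<xi> s + b) (at s within {0..1})"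
      by (fact q)
    show "((\<lambda>s. a * \<gamma> s - 2 * \<theta> * \<xi> s + b) has_real_derivative
        (a\<^sup>2 + 4 * \<rho> * \<theta>) * \<gamma> s + a * b) (at s within {0..1})"
      by (auto intro!: derivative_eq_intros q p simp: algebra_simps power2_eq_square)
  qed
  moreover have "\<exists>\<xi>. hamiltonian_solution (full_symbol (perturbed_OU \<theta> a b \<rho>)) {0..1} \<gamma> \<xi>" if ?E
  proof -
    from that obtain v where
      q: "\<And>s. s \<in> {0..1} \<Longrightarrow> (\<gamma> has_real_derivative v s) (at s within {0..1})" and
      v: "\<And>s. s \<in> {0..1} \<Longrightarrow>
        (v has_real_derivative (a\<^sup>2 + 4 * \<rho> * \<theta>) * \<gamma> s + a * b) (at s within {0..1})"
      by blast
    define \<xi> where "\<xi> s = (a * \<gamma> s + b - v s) / (2 * \<theta>)" for s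
    have "(\<gamma> has_real_derivative a * \<gamma> s - 2 * \<theta> * \<xi> s + b) (at s within {0..1})"
      if "s \<in> {0..1}" for s
    proof -
      have "a * \<gamma> s - 2 * \<theta> * \<xi> s + b = v s"
        using assms by (simp add: \<xi>_def field_simps)
      with q[OF that] show ?thesis by simp
    qed
    moreover have "(\<xi> has_real_derivative - 2 * \<rho> * \<gamma> s - a * \<xi> s) (at s within {0..1})"
      if "s \<in> {0..1}" for s
    proof -
      have "(\<xi> has_real_derivative (a * v s - ((a\<^sup>2 + 4 * \<rho> * \<theta>) * \<gamma> s + a * b)) / (2 * \<theta>))
          (at s within {0..1})"
        unfolding \<xi>_def by (intro DERIV_cdivide) (auto intro!: derivative_eq_intros q v that)
      also have "(a * v s - ((a\<^sup>2 + 4 * \<rho> * \<theta>) * \<gamma> s + a * b)) / (2 * \<theta>) = - 2 * \<rho> * \<gamma> s - a * \<xi> s"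
        using assms by (simp add: \<xi>_def field_simps power2_eq_square)
      finally show ?thesis .
    qed
    ultimately show ?thesis
      unfolding hamiltonian_solution_perturbed_OU by blast
  qed
  ultimately show ?thesis
    unfolding geodesic_def by blast
qed

section \<open>The general solution\<close>

text \<open>
  A fundamental system of \<open>u'' = \<mu> u\<close>, normalised at \<open>0\<close>: the functions \<open>C\<close> and \<open>S\<close> are the solutions
  with \<open>C 0 = 1\<close>, \<open>C' 0 = 0\<close> and \<open>S 0 = 0\<close>, \<open>S' 0 = 1\<close>.  Such solutions satisfy \<open>S' = C\<close> and
  \<open>C' = \<mu> S\<close>, and these first-order relations are used to express that they solve the equation.
\<close>

locale fundamental_system =
  fixes \<mu> :: real and C S :: "real \<Rightarrow> real"
  assumes DERIV_S: "(S has_real_derivative C s) (at s)"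
    and DERIV_C: "(C has_real_derivative \<mu> * S s) (at s)"
    and C_0: "C 0 = 1"
    and S_0: "S 0 = 0"
begin

lemmas DERIV_S_within = has_field_derivative_at_within[OF DERIV_S]
lemmas DERIV_C_within = has_field_derivative_at_within[OF DERIV_C]

lemma pythagorean_identity: "(C s)\<^sup>2 - \<mu> * (S s)\<^sup>2 = 1"
proof -
  have "((\<lambda>s. (C s)\<^sup>2 - \<mu> * (S s)\<^sup>2) has_real_derivative 0) (at t)" for t
    by (auto intro!: derivative_eq_intros DERIV_S DERIV_C)
  then have "(C s)\<^sup>2 - \<mu> * (S s)\<^sup>2 = (C 0)\<^sup>2 - \<mu> * (S 0)\<^sup>2"
    by (intro DERIV_isconst_all) blast
  then show ?thesis by (simp add: C_0 S_0)
qed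

lemma homogeneous_solution:
  assumes u: "\<And>s. s \<in> {0..1} \<Longrightarrow> (u has_real_derivative v s) (at s within {0..1})"
    and v: "\<And>s. s \<in> {0..1} \<Longrightarrow> (v has_real_derivative \<mu> * u s) (at s within {0..1})"
    and s: "s \<in> {0..1}"
  shows "u s = u 0 * C s + v 0 * S s"
proof -
  have const: "f s = f 0"
    if "\<And>t. t \<in> {0..1} \<Longrightarrow> (f has_real_derivative 0) (at t within {0..1})" for f :: "real \<Rightarrow> real"
  proof -
    have "\<exists>c. \<forall>t\<in>{0..1}. f t = c"
      using that by (intro has_field_derivative_zero_constant) auto
    with s show ?thesis by force
  qed
  have 1: "u s * C s - v s * S s = u 0"
  proof -
    have "((\<lambda>t. u t * C t - v t * S t) has_real_derivative 0) (at t within {0..1})"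
      if "t \<in> {0..1}" for t
      by (auto intro!: derivative_eq_intros u v that DERIV_S_within DERIV_C_within)
    from const[OF this] show ?thesis by (simp add: C_0 S_0)
  qed
  have 2: "v s * C s - \<mu> * u s * S s = v 0"
  proof -
    have "((\<lambda>t. v t * C t - \<mu> * u t * S t) has_real_derivative 0) (at t within {0..1})"
      if "t \<in> {0..1}" for t
      by (auto intro!: derivative_eq_intros u v that DERIV_S_within DERIV_C_within)
    from const[OF this] show ?thesis by (simp add: C_0 S_0)
  qed
  \<comment> \<open>Solve the two invariants for \<open>u s\<close>; their determinant is the Pythagorean identity.\<close>
  have "u s = u s * ((C s)\<^sup>2 - \<mu> * (S s)\<^sup>2)"
    by (simp add: pythagorean_identity)
  also have "\<dots> = (u s * C s - v s * S s) * C s + (v s * C s - \<mu> * u s * S s) * S s"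
    by (simp add: algebra_simps power2_eq_square)
  finally show ?thesis
    by (simp only: 1 2)
qed

lemma geodesic_iff_combination:
  assumes \<theta>: "\<theta> \<noteq> 0" and \<mu>: "\<mu> = a\<^sup>2 + 4 * \<rho> * \<theta>"
    and P: "\<And>s. (P has_real_derivative P' s) (at s)"
    and P': "\<And>s. (P' has_real_derivative \<mu> * P s + a * b) (at s)"
  shows "geodesic (perturbed_OU \<theta> a b \<rho>) x\<^sub>0 x \<gamma> \<longleftrightarrow>
    (\<exists>c d. \<forall>s\<in>{0..1}. \<gamma> s = P s + c * C s + d * S s) \<and> \<gamma> 0 = x\<^sub>0 \<and> \<gamma> 1 = x"
proof -
  note P_within = has_field_derivative_at_within[OF P]
  note P'_within = has_field_derivative_at_within[OF P']
  have "(\<exists>v. \<forall>s\<in>{0..1}. (\<gamma> has_real_derivative v s) (at s within {0..1}) \<and>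
        (v has_real_derivative \<mu> * \<gamma> s + a * b) (at s within {0..1})) \<longleftrightarrow>
      (\<exists>c d. \<forall>s\<in>{0..1}. \<gamma> s = P s + c * C s + d * S s)" (is "?L \<longleftrightarrow> ?R")
  proof
    assume ?L
    then obtain v where
      q: "\<And>s. s \<in> {0..1} \<Longrightarrow> (\<gamma> has_real_derivative v s) (at s within {0..1})" and
      v: "\<And>s. s \<in> {0..1} \<Longrightarrow> (v has_real_derivative \<mu> * \<gamma> s + a * b) (at s within {0..1})"
      by blast
    have "\<gamma> s - P s = (\<gamma> 0 - P 0) * C s + (v 0 - P' 0) * S s" if "s \<in> {0..1}" for s
      by (rule homogeneous_solution[where v = "\<lambda>s. v s - P' s", OF _ _ that])
        (auto intro!: derivative_eq_intros q v P_within P'_within simp: algebra_simps)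
    then have "\<forall>s\<in>{0..1}. \<gamma> s = P s + (\<gamma> 0 - P 0) * C s + (v 0 - P' 0) * S s"
      by (simp add: algebra_simps)
    then show ?R by blast
  next
    assume ?R
    then obtain c d where \<gamma>: "\<And>s. s \<in> {0..1} \<Longrightarrow> \<gamma> s = P s + c * C s + d * S s"
      by blast
    define v where "v s = P' s + c * \<mu> * S s + d * C s" for s
    have "(\<gamma> has_real_derivative v s) (at s within {0..1})"
      "(v has_real_derivative \<mu> * \<gamma> s + a * b) (at s within {0..1})" if s: "s \<in> {0..1}" for s
    proof -
      have "((\<lambda>s. P s + c * C s + d * S s) has_real_derivative v s) (at s within {0..1})"
        unfolding v_def
        by (auto intro!: derivative_eq_intros P_within DERIV_S_within DERIV_C_within)
      then show "(\<gamma> has_real_derivative v s) (at s within {0..1})"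
        by (rule has_field_derivative_transform_within[OF _ zero_less_one s]) (simp add: \<gamma>)
      show "(v has_real_derivative \<mu> * \<gamma> s + a * b) (at s within {0..1})"
        unfolding v_def \<gamma>[OF s]
        by (auto intro!: derivative_eq_intros P'_within DERIV_S_within DERIV_C_within
            simp: algebra_simps)
    qed
    then show ?L by blast
  qed
  then show ?thesis
    unfolding geodesic_iff_second_order[OF \<theta>] \<mu> by blast
qed

section \<open>Fitting the endpoints\<close>

text \<open>
  The endpoints of \<open>{0..1}\<close> are called conjugate if \<open>S 1 = 0\<close>, that is, if some nontrivial solution of
  \<open>u'' = \<mu> u\<close> vanishes at both of them.
\<close>

lemma geodesic_iff_nonconjugate:
  assumes "\<theta> \<noteq> 0" "\<mu> = a\<^sup>2 + 4 * \<rho> * \<theta>"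
    and "\<And>s. (P has_real_derivative P' s) (at s)"
    and "\<And>s. (P' has_real_derivative \<mu> * P s + a * b) (at s)"
    and "S 1 \<noteq> 0"
  shows "geodesic (perturbed_OU \<theta> a b \<rho>) x\<^sub>0 x \<gamma> \<longleftrightarrow>
    (\<forall>s\<in>{0..1}. \<gamma> s = P s + (x\<^sub>0 - P 0) * C s + (x - P 1 - (x\<^sub>0 - P 0) * C 1) / S 1 * S s)"
    (is "_ \<longleftrightarrow> ?F")
  unfolding geodesic_iff_combination[OF assms(1-4)]
proof (intro iffI)
  assume "(\<exists>c d. \<forall>s\<in>{0..1}. \<gamma> s = P s + c * C s + d * S s) \<and> \<gamma> 0 = x\<^sub>0 \<and> \<gamma> 1 = x"
  then obtain c d where \<gamma>: "\<forall>s\<in>{0..1}. \<gamma> s = P s + c * C s + d * S s"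
    and x: "x\<^sub>0 = \<gamma> 0" "x = \<gamma> 1"
    by blast
  have "c = x\<^sub>0 - P 0"
    using \<gamma> x by (simp add: C_0 S_0)
  moreover have "x = P 1 + c * C 1 + d * S 1"
    using \<gamma> x by simp
  ultimately have "d = (x - P 1 - (x\<^sub>0 - P 0) * C 1) / S 1"
    using \<open>S 1 \<noteq> 0\<close> by simp
  with \<gamma> \<open>c = x\<^sub>0 - P 0\<close> show ?F by simp
next
  assume F: ?F
  then have "\<gamma> 0 = x\<^sub>0" "\<gamma> 1 = x"
    using \<open>S 1 \<noteq> 0\<close> by (simp_all add: C_0 S_0)
  with F show "(\<exists>c d. \<forall>s\<in>{0..1}. \<gamma> s = P s + c * C s + d * S s) \<and> \<gamma> 0 = x\<^sub>0 \<and> \<gamma> 1 = x"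
    by blast
qed

lemma geodesic_iff_conjugate:
  assumes "\<theta> \<noteq> 0" "\<mu> = a\<^sup>2 + 4 * \<rho> * \<theta>"
    and "\<And>s. (P has_real_derivative P' s) (at s)"
    and "\<And>s. (P' has_real_derivative \<mu> * P s + a * b) (at s)"
    and "S 1 = 0"
  shows "geodesic (perturbed_OU \<theta> a b \<rho>) x\<^sub>0 x \<gamma> \<longleftrightarrow>
    x = P 1 + (x\<^sub>0 - P 0) * C 1 \<and>
    (\<exists>d. \<forall>s\<in>{0..1}. \<gamma> s = P s + (x\<^sub>0 - P 0) * C s + d * S s)"
    (is "_ \<longleftrightarrow> ?F")
  unfolding geodesic_iff_combination[OF assms(1-4)]
proof (intro iffI)
  assume "(\<exists>c d. \<forall>s\<in>{0..1}. \<gamma> s = P s + c * C s + d * S s) \<and> \<gamma> 0 = x\<^sub>0 \<and> \<gamma> 1 = x"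
  then obtain c d where \<gamma>: "\<forall>s\<in>{0..1}. \<gamma> s = P s + c * C s + d * S s"
    and x: "x\<^sub>0 = \<gamma> 0" "x = \<gamma> 1"
    by blast
  have c: "c = x\<^sub>0 - P 0"
    using \<gamma> x by (simp add: C_0 S_0)
  moreover have "x = P 1 + c * C 1"
    using \<gamma> x \<open>S 1 = 0\<close> by simp
  ultimately show ?F
    using \<gamma> by blast
next
  assume F: ?F
  then have "\<gamma> 0 = x\<^sub>0" "\<gamma> 1 = x"
    using \<open>S 1 = 0\<close> by (auto simp: C_0 S_0)
  with F show "(\<exists>c d. \<forall>s\<in>{0..1}. \<gamma> s = P s + c * C s + d * S s) \<and> \<gamma> 0 = x\<^sub>0 \<and> \<gamma> 1 = x"
    by blast
qed

end

section \<open>The three types of fundamental systems\<close>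

lemma fundamental_system_hyperbolic:
  assumes "l \<noteq> 0"
  shows "fundamental_system (l\<^sup>2) (\<lambda>s. cosh (l * s)) (\<lambda>s. sinh (l * s) / l)"
  using assms
  by unfold_locales (auto intro!: derivative_eq_intros simp: power2_eq_square)

lemma fundamental_system_parabolic: "fundamental_system 0 (\<lambda>s. 1) (\<lambda>s. s)"
  by unfold_locales (auto intro!: derivative_eq_intros)

lemma fundamental_system_elliptic:
  assumes "l \<noteq> 0"
  shows "fundamental_system (- l\<^sup>2) (\<lambda>s. cos (l * s)) (\<lambda>s. sin (l * s) / l)"
  using assms
  by unfold_locales (auto intro!: derivative_eq_intros simp: power2_eq_square)

lemma sinh_interpolation:
  fixes l :: real
  assumes "sinh l \<noteq> 0"
  shows "A * cosh (l * s) + (B - A * cosh l) / sinh l * sinh (l * s) =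
    A * (sinh (l * (1 - s)) / sinh l) + B * (sinh (l * s) / sinh l)"
  using assms by (simp add: right_diff_distrib sinh_diff field_simps)

lemma sin_interpolation:
  fixes l :: real
  assumes "sin l \<noteq> 0"
  shows "A * cos (l * s) + (B - A * cos l) / sin l * sin (l * s) =
    A * (sin (l * (1 - s)) / sin l) + B * (sin (l * s) / sin l)"
  using assms by (simp add: right_diff_distrib sin_diff field_simps)

section \<open>Geodesics of the perturbed Ornstein--Uhlenbeck operator\<close>

lemma geodesic_hyperbolic:
  assumes "\<theta> \<noteq> 0" and l: "l > 0" "l\<^sup>2 = a\<^sup>2 + 4 * \<rho> * \<theta>"
  shows "geodesic (perturbed_OU \<theta> a b \<rho>) x\<^sub>0 x \<gamma> \<longleftrightarrow>
    (\<forall>s\<in>{0..1}. \<gamma> s = - (a * b / l\<^sup>2)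
       + (x\<^sub>0 + a * b / l\<^sup>2) * (sinh (l * (1 - s)) / sinh l)
       + (x + a * b / l\<^sup>2) * (sinh (l * s) / sinh l))"
proof -
  interpret fundamental_system "l\<^sup>2" "\<lambda>s. cosh (l * s)" "\<lambda>s. sinh (l * s) / l"
    using l by (intro fundamental_system_hyperbolic) simp
  have sinh: "sinh l \<noteq> 0"
    using l by simp
  have P': "((\<lambda>_. 0) has_real_derivative l\<^sup>2 * - (a * b / l\<^sup>2) + a * b) (at s)" for s
    using l(1) by simp
  have "geodesic (perturbed_OU \<theta> a b \<rho>) x\<^sub>0 x \<gamma> \<longleftrightarrow>
    (\<forall>s\<in>{0..1}. \<gamma> s = - (a * b / l\<^sup>2) + (x\<^sub>0 - - (a * b / l\<^sup>2)) * cosh (l * s)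
      + (x - - (a * b / l\<^sup>2) - (x\<^sub>0 - - (a * b / l\<^sup>2)) * cosh (l * 1)) / (sinh (l * 1) / l)
        * (sinh (l * s) / l))"
    using l(1) sinh by (intro geodesic_iff_nonconjugate[OF \<open>\<theta> \<noteq> 0\<close> l(2) DERIV_const P']) simp
  also have "\<dots> \<longleftrightarrow> (\<forall>s\<in>{0..1}. \<gamma> s = - (a * b / l\<^sup>2) + ((x\<^sub>0 + a * b / l\<^sup>2) * cosh (l * s)
      + (x + a * b / l\<^sup>2 - (x\<^sub>0 + a * b / l\<^sup>2) * cosh l) / sinh l * sinh (l * s)))"
    using l(1) by (simp add: algebra_simps)
  finally show ?thesis
    unfolding sinh_interpolation[OF sinh] by (simp only: add.assoc)
qed

lemma geodesic_parabolic:
  assumes "\<theta> \<noteq> 0" "a\<^sup>2 + 4 * \<rho> * \<theta> = 0"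
  shows "geodesic (perturbed_OU \<theta> a b \<rho>) x\<^sub>0 x \<gamma> \<longleftrightarrow>
    (\<forall>s\<in>{0..1}. \<gamma> s = a * b / 2 * s\<^sup>2 + (x - x\<^sub>0 - a * b / 2) * s + x\<^sub>0)"
proof -
  interpret fundamental_system 0 "\<lambda>s. 1" "\<lambda>s. s"
    by (rule fundamental_system_parabolic)
  have "geodesic (perturbed_OU \<theta> a b \<rho>) x\<^sub>0 x \<gamma> \<longleftrightarrow>
    (\<forall>s\<in>{0..1}. \<gamma> s = a * b / 2 * s\<^sup>2 + (x\<^sub>0 - a * b / 2 * 0\<^sup>2) * 1
      + (x - a * b / 2 * 1\<^sup>2 - (x\<^sub>0 - a * b / 2 * 0\<^sup>2) * 1) / 1 * s)"
  proof (rule geodesic_iff_nonconjugate)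
    show "\<theta> \<noteq> 0" "0 = a\<^sup>2 + 4 * \<rho> * \<theta>"
      by (fact assms(1) assms(2)[symmetric])+
    show "((\<lambda>s. a * b / 2 * s\<^sup>2) has_real_derivative a * b * s) (at s)" for s
      by (auto intro!: derivative_eq_intros)
    show "((\<lambda>s. a * b * s) has_real_derivative 0 * (a * b / 2 * s\<^sup>2) + a * b) (at s)" for s
      by (auto intro!: derivative_eq_intros)
  qed simp
  then show ?thesis
    by (simp add: algebra_simps)
qed

lemma geodesic_elliptic_nonconjugate:
  assumes "\<theta> \<noteq> 0" and l: "l\<^sup>2 = - a\<^sup>2 - 4 * \<rho> * \<theta>" and sin: "sin l \<noteq> 0"
  shows "geodesic (perturbed_OU \<theta> a b \<rho>) x\<^sub>0 x \<gamma> \<longleftrightarrow>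
    (\<forall>s\<in>{0..1}. \<gamma> s = a * b / l\<^sup>2
       + (x\<^sub>0 - a * b / l\<^sup>2) * (sin (l * (1 - s)) / sin l)
       + (x - a * b / l\<^sup>2) * (sin (l * s) / sin l))"
proof -
  have "l \<noteq> 0"
    using sin by auto
  then interpret fundamental_system "- l\<^sup>2" "\<lambda>s. cos (l * s)" "\<lambda>s. sin (l * s) / l"
    by (rule fundamental_system_elliptic)
  have \<mu>: "- l\<^sup>2 = a\<^sup>2 + 4 * \<rho> * \<theta>"
    using l by simp
  have P': "((\<lambda>_. 0) has_real_derivative - l\<^sup>2 * (a * b / l\<^sup>2) + a * b) (at s)" for s
    using \<open>l \<noteq> 0\<close> by simp
  have "geodesic (perturbed_OU \<theta> a b \<rho>) x\<^sub>0 x \<gamma> \<longleftrightarrow>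
    (\<forall>s\<in>{0..1}. \<gamma> s = a * b / l\<^sup>2 + (x\<^sub>0 - a * b / l\<^sup>2) * cos (l * s)
      + (x - a * b / l\<^sup>2 - (x\<^sub>0 - a * b / l\<^sup>2) * cos (l * 1)) / (sin (l * 1) / l)
        * (sin (l * s) / l))"
    using sin \<open>l \<noteq> 0\<close>
    by (intro geodesic_iff_nonconjugate[OF \<open>\<theta> \<noteq> 0\<close> \<mu> DERIV_const P']) simp
  also have "\<dots> \<longleftrightarrow> (\<forall>s\<in>{0..1}. \<gamma> s = a * b / l\<^sup>2 + ((x\<^sub>0 - a * b / l\<^sup>2) * cos (l * s)
      + (x - a * b / l\<^sup>2 - (x\<^sub>0 - a * b / l\<^sup>2) * cos l) / sin l * sin (l * s)))"
    using \<open>l \<noteq> 0\<close> by (simp add: add.assoc)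
  finally show ?thesis
    unfolding sin_interpolation[OF sin] by (simp only: add.assoc)
qed

lemma geodesic_elliptic_conjugate:
  assumes "\<theta> \<noteq> 0" and l: "l \<noteq> 0" "l\<^sup>2 = - a\<^sup>2 - 4 * \<rho> * \<theta>" and sin: "sin l = 0"
  shows "geodesic (perturbed_OU \<theta> a b \<rho>) x\<^sub>0 x \<gamma> \<longleftrightarrow>
    x = a * b / l\<^sup>2 + cos l * (x\<^sub>0 - a * b / l\<^sup>2) \<and>
    (\<exists>c. \<forall>s\<in>{0..1}. \<gamma> s = a * b / l\<^sup>2
       + (x\<^sub>0 - a * b / l\<^sup>2) * (cos (l * s) + a / l * sin (l * s)) - c * sin (l * s))"
    (is "_ \<longleftrightarrow> _ \<and> ?c")
proof -
  interpret fundamental_system "- l\<^sup>2" "\<lambda>s. cos (l * s)" "\<lambda>s. sin (l * s) / l"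
    using l by (intro fundamental_system_elliptic)
  have \<mu>: "- l\<^sup>2 = a\<^sup>2 + 4 * \<rho> * \<theta>"
    using l by simp
  have P': "((\<lambda>_. 0) has_real_derivative - l\<^sup>2 * (a * b / l\<^sup>2) + a * b) (at s)" for s
    using \<open>l \<noteq> 0\<close> by simp
  let ?A = "x\<^sub>0 - a * b / l\<^sup>2"
  have "geodesic (perturbed_OU \<theta> a b \<rho>) x\<^sub>0 x \<gamma> \<longleftrightarrow>
    x = a * b / l\<^sup>2 + ?A * cos (l * 1) \<and>
    (\<exists>d. \<forall>s\<in>{0..1}. \<gamma> s = a * b / l\<^sup>2 + ?A * cos (l * s) + d * (sin (l * s) / l))"
    using sin \<open>l \<noteq> 0\<close>
    by (intro geodesic_iff_conjugate[OF \<open>\<theta> \<noteq> 0\<close> \<mu> DERIV_const P']) simp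
  also have "(\<exists>d. \<forall>s\<in>{0..1}. \<gamma> s = a * b / l\<^sup>2 + ?A * cos (l * s) + d * (sin (l * s) / l)) \<longleftrightarrow> ?c"
  proof -
    \<comment> \<open>The free constants correspond bijectively under \<open>d = A a - c l\<close>.\<close>
    have *: "a * b / l\<^sup>2 + ?A * cos (l * s) + (?A * a - c * l) * (sin (l * s) / l) =
        a * b / l\<^sup>2 + ?A * (cos (l * s) + a / l * sin (l * s)) - c * sin (l * s)" for c s
    proof -
      have "(A * a - c * l) * (t / l) = A * (a / l * t) - c * t" for A t
        using l by (simp add: field_simps)
      then show ?thesis by (simp add: distrib_left)
    qed
    have "\<exists>c. d = ?A * a - c * l" for d
      using l(1) by (intro exI[of _ "(?A * a - d) / l"]) simp
    then have "(\<exists>d. Q d) \<longleftrightarrow> (\<exists>c. Q (?A * a - c * l))" for Q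
      by metis
    then show ?thesis
      unfolding *[symmetric] .
  qed
  finally show ?thesis
    by (simp add: mult.commute)
qed

theorem theorem2p1:
  fixes \<theta> a b \<rho> x\<^sub>0 x :: real
  assumes "\<theta> > 0" and "\<rho> \<noteq> 0"
  shows
    "(a\<^sup>2 + 4 * \<rho> * \<theta> > 0 \<longrightarrow>
       (let lam\<^sub>0 = sqrt (a\<^sup>2 + 4 * \<rho> * \<theta>) in
        \<forall>\<gamma>. geodesic (perturbed_OU \<theta> a b \<rho>) x\<^sub>0 x \<gamma> \<longleftrightarrow>
          (\<forall>s\<in>{0..1}. \<gamma> s =
             - (a * b / lam\<^sub>0\<^sup>2)
             + (x\<^sub>0 + a * b / lam\<^sub>0\<^sup>2) * (sinh (lam\<^sub>0 * (1 - s)) / sinh lam\<^sub>0)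
             + (x + a * b / lam\<^sub>0\<^sup>2) * (sinh (lam\<^sub>0 * s) / sinh lam\<^sub>0))))
   \<and> (a\<^sup>2 + 4 * \<rho> * \<theta> = 0 \<longrightarrow>
       (\<forall>\<gamma>. geodesic (perturbed_OU \<theta> a b \<rho>) x\<^sub>0 x \<gamma> \<longleftrightarrow>
          (\<forall>s\<in>{0..1}. \<gamma> s = a * b / 2 * s\<^sup>2 + (x - x\<^sub>0 - a * b / 2) * s + x\<^sub>0)))
   \<and> (a\<^sup>2 + 4 * \<rho> * \<theta> < 0 \<longrightarrow>
       (let lam\<^sub>0 = sqrt (- a\<^sup>2 - 4 * \<rho> * \<theta>) in
          ((\<forall>k::nat. k > 0 \<longrightarrow> lam\<^sub>0 \<noteq> real k * pi) \<longrightarrow>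
            (\<forall>\<gamma>. geodesic (perturbed_OU \<theta> a b \<rho>) x\<^sub>0 x \<gamma> \<longleftrightarrow>
              (\<forall>s\<in>{0..1}. \<gamma> s =
                 a * b / lam\<^sub>0\<^sup>2
                 + (x\<^sub>0 - a * b / lam\<^sub>0\<^sup>2) * (sin (lam\<^sub>0 * (1 - s)) / sin lam\<^sub>0)
                 + (x - a * b / lam\<^sub>0\<^sup>2) * (sin (lam\<^sub>0 * s) / sin lam\<^sub>0))))
        \<and> (\<forall>k::nat. k > 0 \<and> lam\<^sub>0 = real k * pi \<longrightarrow>
            (x = a * b / ((real k)\<^sup>2 * pi\<^sup>2) + (- 1) ^ k * (x\<^sub>0 - a * b / ((real k)\<^sup>2 * pi\<^sup>2)) \<longrightarrow>
              (\<forall>\<gamma>. geodesic (perturbed_OU \<theta> a b \<rho>) x\<^sub>0 x \<gamma> \<longleftrightarrow>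
                (\<exists>c\<^sub>2::real. \<forall>s\<in>{0..1}. \<gamma> s =
                   a * b / lam\<^sub>0\<^sup>2
                   + (x\<^sub>0 - a * b / ((real k)\<^sup>2 * pi\<^sup>2)) * (cos (lam\<^sub>0 * s) + a / lam\<^sub>0 * sin (lam\<^sub>0 * s))
                   - c\<^sub>2 * sin (lam\<^sub>0 * s))))
          \<and> (x \<noteq> a * b / ((real k)\<^sup>2 * pi\<^sup>2) + (- 1) ^ k * (x\<^sub>0 - a * b / ((real k)\<^sup>2 * pi\<^sup>2)) \<longrightarrow>
              \<not> (\<exists>\<gamma>. geodesic (perturbed_OU \<theta> a b \<rho>) x\<^sub>0 x \<gamma>)))))"
proof (intro conjI impI, unfold Let_def, goal_cases)
  case 1
  then show ?case
    using \<open>\<theta> > 0\<close> by (intro allI geodesic_hyperbolic) auto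
next
  case 2
  then show ?case
    using \<open>\<theta> > 0\<close> by (intro allI geodesic_parabolic) (rule less_imp_neq[symmetric])
next
  case 3
  define l where "l = sqrt (- a\<^sup>2 - 4 * \<rho> * \<theta>)"
  have l: "l > 0" "l \<noteq> 0" "l\<^sup>2 = - a\<^sup>2 - 4 * \<rho> * \<theta>"
    using 3 by (auto simp: l_def)
  have \<theta>: "\<theta> \<noteq> 0"
    using \<open>\<theta> > 0\<close> by simp
  have nonconj: "sin l \<noteq> 0" if "\<forall>k::nat. k > 0 \<longrightarrow> l \<noteq> real k * pi"
  proof
    assume "sin l = 0"
    then obtain i :: int where i: "l = of_int i * pi"
      by (auto simp: sin_zero_iff_int2)
    with l have "i > 0"
      by (simp add: zero_less_mult_iff)
    with that i show False
      by (auto dest!: spec[of _ "nat i"])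
  qed
  have conj: "sin l = 0" "cos l = (- 1) ^ k" "l\<^sup>2 = (real k)\<^sup>2 * pi\<^sup>2" if "l = real k * pi" for k :: nat
    using that by (simp_all add: power_mult_distrib)
  show ?case
    unfolding l_def[symmetric]
  proof (intro conjI allI impI, goal_cases)
    case 1
    then show ?case
      by (intro geodesic_elliptic_nonconjugate \<theta> l nonconj)
  next
    case (2 k \<gamma>)
    then have k: "l = real k * pi" by blast
    from 2(2) show ?case
      using geodesic_elliptic_conjugate[OF \<theta> l(2,3) conj(1)[OF k]]
      unfolding conj(2)[OF k] conj(3)[OF k, symmetric] by blast
  next
    case (3 k)
    then have k: "l = real k * pi" by blast
    from 3(2) show ?case
      using geodesic_elliptic_conjugate[OF \<theta> l(2,3) conj(1)[OF k]]
      unfolding conj(2)[OF k] conj(3)[OF k, symmetric] by blast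
  qed
qed

end
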